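(* Let $\lambda>0$, $0<\nu_1<\nu_2\le1$, and let $n_1\ge0$, $n_2>0$ with $n_1+n_2=1$. The solution to the double-order fractional relaxation equation $$n_1\frac{d^{\nu_1}}{dt^{\nu_1}}\psi+n_2\frac{d^{\nu_2}}{dt^{\nu_2}}\psi=-\lambda\psi,\qquad t>0,$$ with the initial condition $\psi(0)=1$ can be written as $$\psi_{\nu_1,\nu_2}(t)=1-\frac{\lambda t^{\nu_2}}{n_2}\sum_{r=0}^\infty\left(-\frac{n_1t^{\nu_2-\nu_1}}{n_2}\right)^rE^{r+1}_{\nu_2,\nu_2+(\nu_2-\nu_1)r+1}\left(-\frac{\lambda t^{\nu_2}}{n_2}\right).$$
   Context: $\frac{d^\nu}{dt^\nu}$ is the Caputo derivative: for $\nu\in(0,1)$, $\frac{d^\nu}{dt^\nu}u(t)=\frac{1}{\Gamma(1-\nu)}\int_0^t\frac{1}{(t-s)^\nu}\frac{d}{ds}u(s)\,ds$, and for $\nu=1$ it is the ordinary derivative. The generalized Mittag-Leffler function is $$E^\gamma_{\alpha,\beta}(z)=\sum_{j=0}^\infty\frac{(\gamma)_j\,z^j}{j!\,\Gamma(\alpha j+\beta)},\qquad (\gamma)_0=1,\ (\gamma)_j=\gamma(\gamma+1)\cdots(\gamma+j-1).$$ *)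

theory Defs
  imports "HOL-Analysis.Analysis"
begin

definition gen_mittag_leffler_term :: "real \<Rightarrow> real \<Rightarrow> real \<Rightarrow> real \<Rightarrow> nat \<Rightarrow> real" where
  "gen_mittag_leffler_term \<gamma> \<alpha> \<beta> z j =
     pochhammer \<gamma> j * z ^ j / (fact j * Gamma (\<alpha> * real j + \<beta>))"

definition gen_mittag_leffler :: "real \<Rightarrow> real \<Rightarrow> real \<Rightarrow> real \<Rightarrow> real" where
  "gen_mittag_leffler \<gamma> \<alpha> \<beta> z = (\<Sum>j. gen_mittag_leffler_term \<gamma> \<alpha> \<beta> z j)"

definition caputo_deriv :: "real \<Rightarrow> (real \<Rightarrow> real) \<Rightarrow> real \<Rightarrow> real" where
  "caputo_deriv \<nu> u t =
     (if \<nu> = 1 then deriv u t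
      else 1 / Gamma (1 - \<nu>) * (LBINT s:{0<..<t}. 1 / (t - s) powr \<nu> * deriv u s))"

text \<open>Existence of the Caputo derivative at \<open>t\<close>; needed because \<^const>\<open>deriv\<close> and the
  Lebesgue integral are total functions with junk values.\<close>

definition caputo_differentiable :: "real \<Rightarrow> (real \<Rightarrow> real) \<Rightarrow> real \<Rightarrow> bool" where
  "caputo_differentiable \<nu> u t \<longleftrightarrow>
     (if \<nu> = 1 then u differentiable (at t)
      else (\<forall>s\<in>{0<..<t}. u differentiable (at s)) \<and>
           set_integrable lborel {0<..<t} (\<lambda>s. 1 / (t - s) powr \<nu> * deriv u s))"

text \<open>Only the values of \<open>\<psi>\<close> on \<open>[0,\<infinity>)\<close> matter. Continuity up to \<open>0\<close> links the initial
  value to the equation, which holds only for \<open>t > 0\<close>. When \<open>0 < \<nu>\<^sub>1 < 1\<close>, existence of the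
  Caputo derivative of order \<open>\<nu>\<^sub>1\<close> at every \<open>t > 0\<close> already forces \<open>\<psi>\<close> to be differentiable on
  \<open>(0,\<infinity>)\<close> with derivative integrable on every \<open>(0,t)\<close>, since
  \<open>(t - s) powr -\<nu>\<^sub>1 \<ge> t powr -\<nu>\<^sub>1\<close>.\<close>

definition relaxation_solution ::
    "real \<Rightarrow> real \<Rightarrow> real \<Rightarrow> real \<Rightarrow> real \<Rightarrow> (real \<Rightarrow> real) \<Rightarrow> bool" where
  "relaxation_solution lam \<nu>\<^sub>1 \<nu>\<^sub>2 n\<^sub>1 n\<^sub>2 \<psi> \<longleftrightarrow>
     continuous_on {0..} \<psi> \<and> \<psi> 0 = 1 \<and>
     (\<forall>t>0. caputo_differentiable \<nu>\<^sub>1 \<psi> t \<and> caputo_differentiable \<nu>\<^sub>2 \<psi> t \<and>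
        n\<^sub>1 * caputo_deriv \<nu>\<^sub>1 \<psi> t + n\<^sub>2 * caputo_deriv \<nu>\<^sub>2 \<psi> t = - lam * \<psi> t)"

end

theory Submission
  imports Defs
begin

text \<open>
With \<open>K\<^sub>\<mu>(x) = x powr (\<mu> - 1) / \<Gamma>(\<mu>)\<close> for \<open>x > 0\<close>, convolution with \<open>K\<^sub>\<mu>\<close> is the
Riemann--Liouville integral \<open>I\<^sup>\<mu>\<close>, and the Beta integral gives \<open>K\<^sub>\<alpha> * K\<^sub>\<beta> = K\<^sub>\<alpha>\<^sub>+\<^sub>\<beta>\<close>, hence
\<open>I\<^sup>\<alpha> I\<^sup>\<beta> = I\<^sup>\<alpha>\<^sup>+\<^sup>\<beta>\<close>. Put \<open>a = \<nu>\<^sub>2\<close>, \<open>b = \<nu>\<^sub>2 - \<nu>\<^sub>1\<close>, \<open>A = - lam / n\<^sub>2\<close> and \<open>B = - n\<^sub>1 / n\<^sub>2\<close>.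

Existence: since \<open>(r + 1)\<^sub>j / j!\<close> is a binomial coefficient, the asserted solution is \<open>1 + A S\<^sub>a\<^sub>+\<^sub>1\<close>,
where \<open>S\<^sub>e\<close> is the double series of the functions \<open>(r + j choose j) A\<^sup>j B\<^sup>r K\<close> with index
\<open>a j + b r + e\<close>. Termwise, \<open>S\<^sub>e\<^sub>+\<^sub>1\<close> has derivative \<open>S\<^sub>e\<close> and \<open>I\<^sup>\<delta> S\<^sub>e = S\<^sub>e\<^sub>+\<^sub>\<delta>\<close>, so that the Caputo
derivative of order \<open>\<nu>\<close> of the solution is \<open>A S\<^sub>a\<^sub>+\<^sub>1\<^sub>-\<^sub>\<nu>\<close>. The equation then reduces to
\<open>S\<^sub>1 = K\<^sub>1 + A S\<^sub>a\<^sub>+\<^sub>1 + B S\<^sub>b\<^sub>+\<^sub>1\<close>, which is Pascal's rule.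

Uniqueness: applying \<open>I\<^sup>a\<close> to the equation turns it into the Volterra equation
\<open>\<psi> - 1 = B I\<^sup>b (\<psi> - 1) + A I\<^sup>a \<psi>\<close>. As \<open>K\<^sub>\<mu>\<close> has Laplace transform \<open>c powr - \<mu>\<close>, the right-hand side is
a contraction for the supremum norm with weight \<open>exp (- c t)\<close> and \<open>c\<close> large.
\<close>

subsection \<open>Riemann--Liouville kernels\<close>

text \<open>Extending the kernel by zero turns integrals over (0, t) into integrals over the whole
  line, so Fubini meets no moving limits. The integrated function must then vanish for s <= 0,
  whence the factors \<open>indicator {0<..}\<close> below.\<close>

definition rl_kernel :: "real \<Rightarrow> real \<Rightarrow> real" where
  "rl_kernel \<mu> x = (if x > 0 then x powr (\<mu> - 1) / Gamma \<mu> else 0)"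

definition rl_integral :: "real \<Rightarrow> (real \<Rightarrow> real) \<Rightarrow> real \<Rightarrow> real" where
  "rl_integral \<mu> f t = (\<integral>s. rl_kernel \<mu> (t - s) * f s \<partial>lborel)"

lemma Gamma_real_nonzero: "x > 0 \<Longrightarrow> Gamma (x :: real) \<noteq> 0"
  using Gamma_real_pos[of x] by linarith

lemma rl_kernel_nonpos [simp]: "x \<le> 0 \<Longrightarrow> rl_kernel \<mu> x = 0"
  by (simp add: rl_kernel_def)

lemma rl_kernel_nonneg: "\<mu> > 0 \<Longrightarrow> rl_kernel \<mu> x \<ge> 0"
  by (simp add: rl_kernel_def Gamma_real_pos less_imp_le)

lemma rl_kernel_one: "rl_kernel 1 x = (if x > 0 then 1 else 0)"
  by (simp add: rl_kernel_def)

lemma rl_kernel_measurable [measurable]: "rl_kernel \<mu> \<in> borel_measurable borel"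
  unfolding rl_kernel_def [abs_def] by measurable

text \<open>With d = t - u, the substitution s = u + d * x produces Euler's Beta integral. The
  nonnegative integral yields integrability and value together; the general lower end
  \<open>u\<close> serves Fubini later.\<close>

lemma nn_integral_rl_kernel_beta:
  assumes "\<alpha> > 0" "\<beta> > 0"
  shows "(\<integral>\<^sup>+s. ennreal (rl_kernel \<alpha> (t - s) * rl_kernel \<beta> (s - u)) \<partial>lborel) =
         ennreal (rl_kernel (\<alpha> + \<beta>) (t - u))"
proof (cases "u < t")
  case False
  then have "rl_kernel \<alpha> (t - s) * rl_kernel \<beta> (s - u) = 0" for s
    by (cases "s < t") auto
  then have "(\<lambda>s. ennreal (rl_kernel \<alpha> (t - s) * rl_kernel \<beta> (s - u))) = (\<lambda>s. 0)"
    by (intro ext) (simp only: ennreal_0)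
  then show ?thesis using False by simp
next
  case True
  define d where "d = t - u"
  have d: "d > 0" using True by (simp add: d_def)
  \<comment> \<open>\<open>C\<close> gathers the powers of \<open>d\<close> from both kernels and
    the Gamma factors; the Jacobian \<open>d\<close> supplies the remaining power.\<close>
  define C where "C = d powr (\<alpha> + \<beta> - 2) / (Gamma \<alpha> * Gamma \<beta>)"
  have C: "C \<ge> 0" using assms by (simp add: C_def Gamma_real_pos less_imp_le)
  have eq: "rl_kernel \<alpha> (t - (u + d * x)) * rl_kernel \<beta> (u + d * x - u) =
      C * (indicator {0..1} x * (x powr (\<beta> - 1) * (1 - x) powr (\<alpha> - 1)))" for x
  proof (cases "0 < x \<and> x < 1")
    case True
    have "t - (u + d * x) = d * (1 - x)" by (simp add: d_def algebra_simps)
    moreover have "d * (1 - x) > 0" "d * x > 0" using True d by auto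
    moreover have "d powr (\<alpha> + \<beta> - 2) = d powr (\<alpha> - 1) * d powr (\<beta> - 1)"
      by (simp flip: powr_add)
    ultimately show ?thesis using True d
      by (simp add: rl_kernel_def C_def powr_mult)
  next
    case False
    moreover have "t - (u + d * x) = d * (1 - x)" by (simp add: d_def algebra_simps)
    \<comment> \<open>At x = 0 and x = 1 the indicator is 1, but \<open>0 powr _\<close> is 0, in
      agreement with \<open>rl_kernel\<close> at 0.\<close>
    ultimately show ?thesis using d
      by (cases "x = 0 \<or> x = 1")
        (auto simp: rl_kernel_def zero_less_mult_iff indicator_def)
  qed
  have "Beta \<beta> \<alpha> \<ge> 0" using assms by (simp add: Beta_def Gamma_real_pos less_imp_le)
  have "(\<integral>\<^sup>+s. ennreal (rl_kernel \<alpha> (t - s) * rl_kernel \<beta> (s - u)) \<partial>lborel) =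
      ennreal d * (\<integral>\<^sup>+x. ennreal (C * (indicator {0..1} x * (x powr (\<beta> - 1) * (1 - x) powr (\<alpha> - 1)))) \<partial>lborel)"
    using d by (subst nn_integral_real_affine[where c = d and t = u]) (simp_all only: eq, simp_all)
  also have "(\<integral>\<^sup>+x. ennreal (C * (indicator {0..1} x * (x powr (\<beta> - 1) * (1 - x) powr (\<alpha> - 1)))) \<partial>lborel) =
     ennreal C * (\<integral>\<^sup>+x. ennreal (indicator {0..1} x * (x powr (\<beta> - 1) * (1 - x) powr (\<alpha> - 1))) \<partial>lborel)"
    using C by (simp add: ennreal_mult' nn_integral_cmult)
  also have "(\<integral>\<^sup>+x. ennreal (indicator {0..1} x * (x powr (\<beta> - 1) * (1 - x) powr (\<alpha> - 1))) \<partial>lborel) =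
     ennreal (Beta \<beta> \<alpha>)"
    using has_integral_Beta_real[of \<beta> \<alpha>] assms
    by (intro nn_integral_has_integral_lebesgue) auto
  also have "ennreal d * (ennreal C * ennreal (Beta \<beta> \<alpha>)) = ennreal (d * (C * Beta \<beta> \<alpha>))"
    using d C \<open>Beta \<beta> \<alpha> \<ge> 0\<close> by (simp add: ennreal_mult')
  also have "d * (C * Beta \<beta> \<alpha>) = rl_kernel (\<alpha> + \<beta>) (t - u)"
  proof -
    have "d * d powr (\<alpha> + \<beta> - 2) = d powr (\<alpha> + \<beta> - 1)"
      using d by (simp add: powr_mult_base)
    then show ?thesis
      using assms d Gamma_real_nonzero[of \<alpha>] Gamma_real_nonzero[of \<beta>]
      by (simp add: rl_kernel_def C_def Beta_def add.commute flip: d_def)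
  qed
  finally show ?thesis .
qed

lemma
  assumes "\<alpha> > 0" "\<beta> > 0"
  shows integrable_rl_kernel_beta: "integrable lborel (\<lambda>s. rl_kernel \<alpha> (t - s) * rl_kernel \<beta> (s - u))"
    and integral_rl_kernel_beta:
      "(\<integral>s. rl_kernel \<alpha> (t - s) * rl_kernel \<beta> (s - u) \<partial>lborel) = rl_kernel (\<alpha> + \<beta>) (t - u)"
proof -
  have *: "rl_kernel \<alpha> (t - s) * rl_kernel \<beta> (s - u) \<ge> 0" for s
    using assms by (simp add: rl_kernel_nonneg)
  show "integrable lborel (\<lambda>s. rl_kernel \<alpha> (t - s) * rl_kernel \<beta> (s - u))"
    using * nn_integral_rl_kernel_beta[OF assms] by (intro integrableI_nonneg) auto
  show "(\<integral>s. rl_kernel \<alpha> (t - s) * rl_kernel \<beta> (s - u) \<partial>lborel) = rl_kernel (\<alpha> + \<beta>) (t - u)"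
    using * nn_integral_rl_kernel_beta[OF assms] rl_kernel_nonneg[of "\<alpha> + \<beta>"] assms
    by (intro integral_eq_nn_integral[THEN trans]) (auto simp: enn2real_ennreal)
qed

text \<open>This is the Laplace transform of the kernel: s = t - x / c leads to Euler's integral for
  Gamma. The integral runs over all s < t and so majorizes the one over (0, t).\<close>

lemma nn_integral_rl_kernel_exp:
  assumes "\<mu> > 0" "c > 0"
  shows "(\<integral>\<^sup>+s. ennreal (rl_kernel \<mu> (t - s) * exp (c * s)) \<partial>lborel) = ennreal (c powr (- \<mu>) * exp (c * t))"
proof -
  define C where "C = c powr (1 - \<mu>) * exp (c * t) / Gamma \<mu>"
  have C: "C \<ge> 0" using assms by (simp add: C_def Gamma_real_pos less_imp_le)
  have eq: "rl_kernel \<mu> (t - (t + (- 1 / c) * x)) * exp (c * (t + (- 1 / c) * x)) =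
      C * (indicator {0..} x * x powr (\<mu> - 1) / exp x)" for x
  proof (cases "x > 0")
    case True
    have "(x / c) powr (\<mu> - 1) = x powr (\<mu> - 1) * c powr (1 - \<mu>)"
      using assms True powr_minus_divide[of c "\<mu> - 1"] by (simp add: powr_divide)
    moreover have "c * (t + (- 1 / c) * x) = c * t - x"
      using assms by (simp add: field_simps)
    ultimately show ?thesis using True assms
      by (simp add: rl_kernel_def C_def exp_diff)
  qed (use assms in \<open>auto simp: rl_kernel_def zero_less_divide_iff indicator_def\<close>)
  have "(\<integral>\<^sup>+s. ennreal (rl_kernel \<mu> (t - s) * exp (c * s)) \<partial>lborel) =
     ennreal \<bar>- 1 / c\<bar> * (\<integral>\<^sup>+x. ennreal (C * (indicator {0..} x * x powr (\<mu> - 1) / exp x)) \<partial>lborel)"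
    using assms by (subst nn_integral_real_affine[where c = "- 1 / c" and t = t]) (simp_all only: eq, simp_all)
  also have "(\<integral>\<^sup>+x. ennreal (C * (indicator {0..} x * x powr (\<mu> - 1) / exp x)) \<partial>lborel) =
    ennreal C * (\<integral>\<^sup>+x. ennreal (indicator {0..} x * x powr (\<mu> - 1) / exp x) \<partial>lborel)"
    using C by (simp only: ennreal_mult') (subst nn_integral_cmult, auto)
  also have "(\<integral>\<^sup>+x. ennreal (indicator {0..} x * x powr (\<mu> - 1) / exp x) \<partial>lborel) = ennreal (Gamma \<mu>)"
    using Gamma_conv_nn_integral_real[of \<mu>] assms by simp
  also have "ennreal \<bar>- 1 / c\<bar> * (ennreal C * ennreal (Gamma \<mu>)) = ennreal (\<bar>- 1 / c\<bar> * (C * Gamma \<mu>))"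
    using C by (simp only: ennreal_mult' abs_ge_zero)
  also have "\<bar>- 1 / c\<bar> * (C * Gamma \<mu>) = c powr (- \<mu>) * exp (c * t)"
  proof -
    have "c powr (1 - \<mu>) = c * c powr (- \<mu>)"
      using assms by (simp add: powr_mult_base)
    then show ?thesis
      using assms Gamma_real_nonzero[of \<mu>] by (simp add: C_def)
  qed
  finally show ?thesis .
qed

lemma
  assumes "\<mu> > 0" "c > 0"
  shows integrable_rl_kernel_exp: "integrable lborel (\<lambda>s. rl_kernel \<mu> (t - s) * exp (c * s))"
    and integral_rl_kernel_exp:
      "(\<integral>s. rl_kernel \<mu> (t - s) * exp (c * s) \<partial>lborel) = c powr (- \<mu>) * exp (c * t)"
proof -
  have *: "rl_kernel \<mu> (t - s) * exp (c * s) \<ge> 0" for s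
    using assms by (simp add: rl_kernel_nonneg)
  show "integrable lborel (\<lambda>s. rl_kernel \<mu> (t - s) * exp (c * s))"
    using * nn_integral_rl_kernel_exp[OF assms] by (intro integrableI_nonneg) auto
  show "(\<integral>s. rl_kernel \<mu> (t - s) * exp (c * s) \<partial>lborel) = c powr (- \<mu>) * exp (c * t)"
    using * nn_integral_rl_kernel_exp[OF assms]
    by (intro integral_eq_nn_integral[THEN trans]) (auto simp: enn2real_ennreal)
qed

section \<open>Growth of the kernels in their order, and their derivative\<close>

text \<open>Gamma (x + 1) is at least the part of its integral beyond \<open>t\<close>, where u powr
  x >= t powr x, and there exp (- u) integrates to exp (- t).\<close>

lemma powr_le_Gamma_exp:
  fixes t x :: real
  assumes "t \<ge> 0" "x \<ge> 0"
  shows "t powr x \<le> Gamma (x + 1) * exp t"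
proof -
  have "ennreal (t powr x) * (\<integral>\<^sup>+u. ennreal (indicator {t..} u / exp u) \<partial>lborel) =
        (\<integral>\<^sup>+u. ennreal (t powr x * (indicator {t..} u / exp u)) \<partial>lborel)"
    by (simp only: ennreal_mult' powr_ge_zero) (subst nn_integral_cmult, auto)
  also have "\<dots> \<le> (\<integral>\<^sup>+u. ennreal (indicator {0..} u * u powr (x + 1 - 1) / exp u) \<partial>lborel)"
    using assms by (intro nn_integral_mono ennreal_leI)
      (auto simp: indicator_def intro!: divide_right_mono powr_mono2)
  also have "\<dots> = ennreal (Gamma (x + 1))"
    using Gamma_conv_nn_integral_real[of "x + 1"] assms by simp
  also have "(\<integral>\<^sup>+u. ennreal (indicator {t..} u / exp u) \<partial>lborel) = ennreal (exp (- t))"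
  proof -
    have "((\<lambda>u. exp (- 1 * u)) has_integral exp (- 1 * t) / 1) {t..}"
      by (rule has_integral_exp_minus_to_infinity) simp
    from nn_integral_has_integral_lebesgue[OF _ this]
    show ?thesis by (simp add: exp_minus divide_inverse)
  qed
  also have "ennreal (t powr x) * ennreal (exp (- t)) = ennreal (t powr x * exp (- t))"
    by (simp add: ennreal_mult')
  finally have "t powr x * exp (- t) \<le> Gamma (x + 1)"
    using assms by (subst (asm) ennreal_le_iff) (auto intro!: less_imp_le Gamma_real_pos)
  then show ?thesis by (simp add: exp_minus field_simps)
qed

text \<open>The free parameter \<sigma> buys geometric decay in the order \<open>x\<close> at the
  price of growth in \<open>t\<close>. The previous bound is taken at exp 1 * \<sigma> * t, whose
  extra factor exp x absorbs the \<open>x\<close> in Gamma (x + 1) = x * Gamma x.\<close>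

lemma rl_kernel_bound:
  assumes "t > 0" "\<sigma> > 0" "x > 0"
  shows "rl_kernel x t \<le> exp (exp 1 * \<sigma> * t) / t * \<sigma> powr (- x)"
proof -
  have "(exp 1 * \<sigma> * t) powr x \<le> Gamma (x + 1) * exp (exp 1 * \<sigma> * t)"
    using assms by (intro powr_le_Gamma_exp) auto
  moreover have "(exp 1 * \<sigma> * t) powr x = exp x * \<sigma> powr x * t powr x"
    using assms by (simp add: powr_mult powr_def[of "exp 1"])
  moreover have "Gamma (x + 1) = x * Gamma x"
    using assms by (subst Gamma_plus1) (auto simp: nonpos_Ints_def)
  moreover have "x * (\<sigma> powr x * t powr x) \<le> exp x * \<sigma> powr x * t powr x"
    using exp_ge_add_one_self[of x] assms
    unfolding mult.assoc by (intro mult_right_mono) (linarith, simp)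
  ultimately have "x * (\<sigma> powr x * t powr x) \<le> x * Gamma x * exp (exp 1 * \<sigma> * t)"
    by (metis order_trans)
  then have "\<sigma> powr x * t powr x \<le> Gamma x * exp (exp 1 * \<sigma> * t)"
    using assms unfolding mult.assoc by simp
  then show ?thesis
    using assms Gamma_real_pos[of x]
    by (simp add: rl_kernel_def powr_diff powr_minus field_simps)
qed

lemma DERIV_rl_kernel:
  assumes "t > 0" "x > 0"
  shows "(rl_kernel (x + 1) has_real_derivative rl_kernel x t) (at t)"
proof -
  have "((\<lambda>t. t powr x / Gamma (x + 1)) has_real_derivative x * t powr (x - 1) / Gamma (x + 1)) (at t)"
    using assms Gamma_real_nonzero[of "x + 1"]
    by (auto intro!: derivative_eq_intros)
  moreover have "x * t powr (x - 1) / Gamma (x + 1) = rl_kernel x t"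
    using assms Gamma_plus1[of x] by (auto simp: rl_kernel_def nonpos_Ints_def)
  ultimately have "((\<lambda>t. t powr x / Gamma (x + 1)) has_real_derivative rl_kernel x t) (at t)"
    by simp
  then show ?thesis
    by (rule has_field_derivative_transform_within_open[where S = "{0<..}"])
      (use assms in \<open>auto simp: rl_kernel_def\<close>)
qed

subsection \<open>Riemann--Liouville integrals\<close>

text \<open>Both kernels are nonnegative, so the Beta integral evaluates the inner integral of the
  norm exactly, and \<open>int\<close> becomes the absolute integrability that Fubini asks for. The
  integral \<open>rl_integral \<beta> g s\<close> converges for almost every s < t, which
  suffices.\<close>

lemma
  assumes "\<alpha> > 0" "\<beta> > 0" and [measurable]: "g \<in> borel_measurable borel"
    and int: "integrable lborel (\<lambda>u. rl_kernel (\<alpha> + \<beta>) (t - u) * g u)"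
  shows integrable_rl_integral: "integrable lborel (\<lambda>s. rl_kernel \<alpha> (t - s) * rl_integral \<beta> g s)"
    and rl_integral_rl_integral: "rl_integral \<alpha> (rl_integral \<beta> g) t = rl_integral (\<alpha> + \<beta>) g t"
proof -
  define F where "F u s = rl_kernel \<alpha> (t - s) * rl_kernel \<beta> (s - u) * g u" for u s
  have inner: "(\<integral>s. F u s \<partial>lborel) = rl_kernel (\<alpha> + \<beta>) (t - u) * g u" for u
    using integral_rl_kernel_beta[OF assms(1,2)] by (simp add: F_def)
  have norm_inner: "(\<integral>s. norm (F u s) \<partial>lborel) = norm (rl_kernel (\<alpha> + \<beta>) (t - u) * g u)" for u
    using integral_rl_kernel_beta[OF assms(1,2)] assms(1,2)
    by (simp add: F_def abs_mult rl_kernel_nonneg)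
  have F: "integrable (lborel \<Otimes>\<^sub>M lborel) (\<lambda>(u, s). F u s)"
  proof (rule lborel_pair.Fubini_integrable)
    show "(\<lambda>(u, s). F u s) \<in> borel_measurable (lborel \<Otimes>\<^sub>M lborel)"
      unfolding F_def by measurable
    show "integrable lborel (\<lambda>u. \<integral>s. norm ((\<lambda>(u, s). F u s) (u, s)) \<partial>lborel)"
      using integrable_norm[OF int] by (simp only: norm_inner prod.case)
    show "AE u in lborel. integrable lborel (\<lambda>s. (\<lambda>(u, s). F u s) (u, s))"
      using integrable_rl_kernel_beta[OF assms(1,2)] by (simp add: F_def)
  qed
  have outer: "(\<integral>u. F u s \<partial>lborel) = rl_kernel \<alpha> (t - s) * rl_integral \<beta> g s" for s
    by (simp add: F_def rl_integral_def mult.assoc)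
  show "integrable lborel (\<lambda>s. rl_kernel \<alpha> (t - s) * rl_integral \<beta> g s)"
    using lborel_pair.integrable_snd[OF F] by (simp only: outer)
  show "rl_integral \<alpha> (rl_integral \<beta> g) t = rl_integral (\<alpha> + \<beta>) g t"
    using lborel_pair.Fubini_integral[OF F] unfolding outer inner by (simp add: rl_integral_def)
qed

text \<open>By the Beta integral the norms of the terms integrate to the terms of
  \<open>total\<close>, which justifies exchanging sum and integral.\<close>

lemma
  fixes c x :: "nat \<Rightarrow> real"
  assumes "\<delta> > 0" "\<And>k. x k > 0"
    and pointwise: "\<And>s. s > 0 \<Longrightarrow> summable (\<lambda>k. \<bar>c k\<bar> * rl_kernel (x k) s)"
    and total: "summable (\<lambda>k. \<bar>c k\<bar> * rl_kernel (x k + \<delta>) t)"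
  shows integrable_rl_kernel_suminf:
      "integrable lborel (\<lambda>s. rl_kernel \<delta> (t - s) * (\<Sum>k. c k * rl_kernel (x k) s))"
    and rl_integral_suminf:
      "rl_integral \<delta> (\<lambda>s. \<Sum>k. c k * rl_kernel (x k) s) t = (\<Sum>k. c k * rl_kernel (x k + \<delta>) t)"
proof -
  \<comment> \<open>Writing \<open>s - 0\<close> exhibits the Beta integral with u = 0.\<close>
  define f where "f k s = c k * (rl_kernel \<delta> (t - s) * rl_kernel (x k) (s - 0))" for k s
  have f: "integrable lborel (f k)" for k
    unfolding f_def using assms(1,2) by (intro integrable_mult_right integrable_rl_kernel_beta)
  have int_f: "integral\<^sup>L lborel (f k) = c k * rl_kernel (x k + \<delta>) t" for k
    unfolding f_def using assms(1,2) by (simp add: integral_rl_kernel_beta[where u = 0, simplified] add.commute)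
  have int_norm_f: "(\<integral>s. norm (f k s) \<partial>lborel) = \<bar>c k\<bar> * rl_kernel (x k + \<delta>) t" for k
    unfolding f_def using assms(1,2)
    by (simp add: integral_rl_kernel_beta[where u = 0, simplified] add.commute abs_mult rl_kernel_nonneg)
  have pw: "summable (\<lambda>k. \<bar>c k\<bar> * rl_kernel (x k) s)" for s
    using pointwise[of s] by (cases "s > 0") auto
  have "summable (\<lambda>k. norm (f k s))" for s
  proof -
    have "norm (f k s) = rl_kernel \<delta> (t - s) * (\<bar>c k\<bar> * rl_kernel (x k) s)" for k
      using assms(1,2) by (simp add: f_def abs_mult rl_kernel_nonneg)
    then show ?thesis using summable_mult[OF pw[of s]] by simp
  qed
  then have ae: "AE s in lborel. summable (\<lambda>k. norm (f k s))" by simp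
  have tot: "summable (\<lambda>k. \<integral>s. norm (f k s) \<partial>lborel)"
    using total by (simp only: int_norm_f)
  have eq: "(\<Sum>k. f k s) = rl_kernel \<delta> (t - s) * (\<Sum>k. c k * rl_kernel (x k) s)" for s
  proof -
    have "summable (\<lambda>k. c k * rl_kernel (x k) s)"
      by (rule summable_norm_cancel)
        (use pw[of s] assms(2) in \<open>simp add: abs_mult rl_kernel_nonneg\<close>)
    from suminf_mult[OF this, of "rl_kernel \<delta> (t - s)"] show ?thesis
      by (simp add: f_def mult_ac)
  qed
  show "integrable lborel (\<lambda>s. rl_kernel \<delta> (t - s) * (\<Sum>k. c k * rl_kernel (x k) s))"
    using integrable_suminf[OF f ae tot] by (simp only: eq)
  show "rl_integral \<delta> (\<lambda>s. \<Sum>k. c k * rl_kernel (x k) s) t = (\<Sum>k. c k * rl_kernel (x k + \<delta>) t)"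
    using integral_suminf[OF f ae tot] by (simp only: eq int_f rl_integral_def)
qed

section \<open>Measurability and integrability extracted from products with a kernel\<close>

text \<open>Dividing the integrable product by the kernel recovers \<open>g\<close> below
  \<open>t\<close>, and t = n + 1 exhausts the line. This supplies measurability of the derivative
  of a solution, which the Caputo conditions contain only implicitly.\<close>

lemma rl_kernel_integrable_imp_measurable:
  assumes "\<mu> > 0" "\<And>t. t > 0 \<Longrightarrow> integrable lborel (\<lambda>s. rl_kernel \<mu> (t - s) * g s)"
  shows "g \<in> borel_measurable borel"
proof (rule borel_measurable_LIMSEQ_real)
  define h where "h n s = (rl_kernel \<mu> (real (Suc n) - s) * g s) / rl_kernel \<mu> (real (Suc n) - s)" for n s
  have h: "h n s = g s" if "s < real (Suc n)" for n s
    using that assms(1) Gamma_real_nonzero[of \<mu>] by (simp add: h_def rl_kernel_def)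
  show "(\<lambda>n. h n s) \<longlonglongrightarrow> g s" for s
  proof (rule tendsto_eventually)
    obtain N where "s < real N" using reals_Archimedean2 by blast
    then show "\<forall>\<^sub>F n in sequentially. h n s = g s"
      unfolding eventually_sequentially using h by (metis le_SucI less_le_trans of_nat_mono)
  qed
  show "h n \<in> borel_measurable borel" for n
  proof -
    have "(\<lambda>s. rl_kernel \<mu> (real (Suc n) - s) * g s) \<in> borel_measurable lborel"
      by (intro borel_measurable_integrable assms(2)) simp
    then have [measurable]: "(\<lambda>s. rl_kernel \<mu> (real (Suc n) - s) * g s) \<in> borel_measurable borel"
      by simp
    show ?thesis unfolding h_def by measurable
  qed
qed

text \<open>On (0, t) the quotient of the kernels is a constant times (t - s) powr (\<mu>' - \<mu>),
  bounded by its value at s = 0; \<open>g0\<close> removes the points where t - s exceeds t.\<close>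

lemma integrable_rl_kernel_mono:
  assumes "0 < \<mu>" "\<mu> \<le> \<mu>'" and [measurable]: "g \<in> borel_measurable borel"
    and g0: "\<And>s. s \<le> 0 \<Longrightarrow> g s = 0"
    and int: "integrable lborel (\<lambda>s. rl_kernel \<mu> (t - s) * g s)"
  shows "integrable lborel (\<lambda>s. rl_kernel \<mu>' (t - s) * g s)"
proof (rule Bochner_Integration.integrable_bound)
  define C where "C = t powr (\<mu>' - \<mu>) * Gamma \<mu> / Gamma \<mu>'"
  show "integrable lborel (\<lambda>s. C * (rl_kernel \<mu> (t - s) * g s))"
    using int by (rule integrable_mult_right)
  have pos: "Gamma \<mu> > 0" "Gamma \<mu>' > 0" using assms by (auto simp: Gamma_real_pos)
  have "norm (rl_kernel \<mu>' (t - s) * g s) \<le> norm (C * (rl_kernel \<mu> (t - s) * g s))" for s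
  proof (cases "0 < s \<and> s < t")
    case True
    have "(t - s) powr (\<mu>' - 1) = (t - s) powr (\<mu>' - \<mu>) * (t - s) powr (\<mu> - 1)"
      by (simp flip: powr_add)
    also have "\<dots> \<le> t powr (\<mu>' - \<mu>) * (t - s) powr (\<mu> - 1)"
      using True assms by (intro mult_right_mono powr_mono2) auto
    finally have "(t - s) powr (\<mu>' - 1) / Gamma \<mu>' \<le> C * ((t - s) powr (\<mu> - 1) / Gamma \<mu>)"
      using pos by (simp add: C_def divide_right_mono)
    then have "rl_kernel \<mu>' (t - s) \<le> C * rl_kernel \<mu> (t - s)"
      using True by (simp add: rl_kernel_def)
    then have "rl_kernel \<mu>' (t - s) * \<bar>g s\<bar> \<le> C * rl_kernel \<mu> (t - s) * \<bar>g s\<bar>"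
      by (intro mult_right_mono) auto
    moreover have "C \<ge> 0" using pos by (simp add: C_def)
    ultimately show ?thesis using assms(1,2)
      by (simp add: abs_mult rl_kernel_nonneg mult.assoc)
  qed (use g0 in \<open>auto simp: not_less\<close>)
  then show "AE s in lborel. norm (rl_kernel \<mu>' (t - s) * g s) \<le> norm (C * (rl_kernel \<mu> (t - s) * g s))"
    by simp
qed measurable

section \<open>Volterra uniqueness, and the fundamental theorem of calculus for Lebesgue
  integrals\<close>

text \<open>The equation is evaluated at a point where the weighted maximum \<open>M\<close> over
  [0, T] is attained. It bounds \<open>M\<close> by M / 2 there, so \<open>M\<close>
  vanishes.\<close>

lemma volterra_unique:
  fixes w :: "real \<Rightarrow> real"
  assumes "a > 0" "b > 0" and cont: "continuous_on {0..} w" and "w 0 = 0"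
    and eq: "\<And>t. t > 0 \<Longrightarrow> w t = B * rl_integral b (\<lambda>s. indicator {0<..} s * w s) t +
                                A * rl_integral a (\<lambda>s. indicator {0<..} s * w s) t"
    and "T \<ge> 0"
  shows "w T = 0"
proof -
  \<comment> \<open>Both powers tend to 0 as \<open>c\<close> grows, so the contraction constant can
    be made smaller than 1 / 2.\<close>
  have "((\<lambda>c. \<bar>B\<bar> * c powr (- b) + \<bar>A\<bar> * c powr (- a)) \<longlongrightarrow> \<bar>B\<bar> * 0 + \<bar>A\<bar> * 0) at_top"
    using assms by (intro tendsto_intros tendsto_neg_powr filterlim_ident) auto
  then have "\<forall>\<^sub>F c in at_top. \<bar>B\<bar> * c powr (- b) + \<bar>A\<bar> * c powr (- a) < 1 / 2"
    by (rule order_tendstoD) simp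
  then have "\<forall>\<^sub>F c in at_top. \<bar>B\<bar> * c powr (- b) + \<bar>A\<bar> * c powr (- a) < 1 / 2 \<and> c > (0 :: real)"
    by (intro eventually_conj eventually_gt_at_top)
  then obtain c :: real where c: "c > 0" "\<bar>B\<bar> * c powr (- b) + \<bar>A\<bar> * c powr (- a) < 1 / 2"
    by (auto dest: eventually_happens)
  have "continuous_on {0..T} (\<lambda>s. exp (- c * s) * \<bar>w s\<bar>)"
    by (intro continuous_intros continuous_on_subset[OF cont]) auto
  from continuous_attains_sup[OF _ _ this] \<open>T \<ge> 0\<close>
  obtain x where x: "x \<in> {0..T}"
    and max: "\<And>s. s \<in> {0..T} \<Longrightarrow> exp (- c * s) * \<bar>w s\<bar> \<le> exp (- c * x) * \<bar>w x\<bar>"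
    by (metis atLeastatMost_empty_iff2 compact_Icc not_less)
  define M where "M = exp (- c * x) * \<bar>w x\<bar>"
  have M: "M \<ge> 0" by (simp add: M_def)
  have w_le: "\<bar>w s\<bar> \<le> M * exp (c * s)" if "s \<in> {0..T}" for s
    using max[OF that] by (simp add: M_def exp_minus field_simps)
  have "M = 0"
  \<comment> \<open>The equation is given for t > 0; a maximum at 0 is settled by the initial
    value.\<close>
  proof (cases "x = 0")
    case True
    then show ?thesis using \<open>w 0 = 0\<close> by (simp add: M_def)
  next
    case False
    have bound: "\<bar>rl_integral \<mu> (\<lambda>s. indicator {0<..} s * w s) x\<bar> \<le> M * (c powr (- \<mu>) * exp (c * x))"
      if "\<mu> > 0" for \<mu>
    proof -
      have "\<bar>rl_integral \<mu> (\<lambda>s. indicator {0<..} s * w s) x\<bar> \<le>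
          (\<integral>s. norm (rl_kernel \<mu> (x - s) * (indicator {0<..} s * w s)) \<partial>lborel)"
        unfolding rl_integral_def real_norm_def [symmetric] by (rule integral_norm_bound)
      also have "\<dots> \<le> (\<integral>s. M * (rl_kernel \<mu> (x - s) * exp (c * s)) \<partial>lborel)"
      \<comment> \<open>Integrability is checked for the majorant: the default value 0 of a
        divergent integral on the left would still respect the bound.\<close>
      proof (rule integral_mono')
        show "integrable lborel (\<lambda>s. M * (rl_kernel \<mu> (x - s) * exp (c * s)))"
          using that c by (intro integrable_mult_right integrable_rl_kernel_exp)
        show "0 \<le> M * (rl_kernel \<mu> (x - s) * exp (c * s))" for s
          using M that by (simp add: rl_kernel_nonneg)
        show "norm (rl_kernel \<mu> (x - s) * (indicator {0<..} s * w s)) \<le>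
            M * (rl_kernel \<mu> (x - s) * exp (c * s))" for s
        proof (cases "0 < s \<and> s < x")
          case True
          then have "rl_kernel \<mu> (x - s) * \<bar>w s\<bar> \<le> rl_kernel \<mu> (x - s) * (M * exp (c * s))"
            using x that by (intro mult_left_mono w_le) (auto simp: rl_kernel_nonneg)
          then show ?thesis using True that by (simp add: abs_mult rl_kernel_nonneg mult_ac)
        qed (use M that in \<open>auto simp: not_less rl_kernel_nonneg\<close>)
      qed
      finally show ?thesis using that c by (simp add: integral_rl_kernel_exp)
    qed
    have "\<bar>w x\<bar> \<le> \<bar>B\<bar> * \<bar>rl_integral b (\<lambda>s. indicator {0<..} s * w s) x\<bar> +
        \<bar>A\<bar> * \<bar>rl_integral a (\<lambda>s. indicator {0<..} s * w s) x\<bar>"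
      using eq[of x] x False by (metis abs_mult abs_triangle_ineq atLeastAtMost_iff less_eq_real_def)
    also have "\<dots> \<le> \<bar>B\<bar> * (M * (c powr (- b) * exp (c * x))) + \<bar>A\<bar> * (M * (c powr (- a) * exp (c * x)))"
      using assms by (intro add_mono mult_left_mono bound) auto
    also have "\<dots> = (\<bar>B\<bar> * c powr (- b) + \<bar>A\<bar> * c powr (- a)) * (M * exp (c * x))"
      by (simp add: algebra_simps)
    also have "\<dots> \<le> 1 / 2 * (M * exp (c * x))"
      using M by (intro mult_right_mono less_imp_le[OF c(2)]) simp
    also have "\<dots> = \<bar>w x\<bar> / 2"
      by (simp add: M_def exp_minus)
    finally show "M = 0" by (simp add: M_def)
  qed
  with w_le[of T] \<open>T \<ge> 0\<close> show ?thesis by simp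
qed

text \<open>The interior form of the fundamental theorem handles the endpoint 0, where
  \<open>u\<close> is merely continuous, and gives a gauge integral; \<open>int\<close> identifies
  it with the Lebesgue integral.\<close>

lemma set_lebesgue_integral_deriv:
  fixes u :: "real \<Rightarrow> real"
  assumes "t \<ge> 0" and cont: "continuous_on {0..} u" and "\<And>s. s > 0 \<Longrightarrow> u differentiable (at s)"
    and int: "set_integrable lborel {0<..<t} (deriv u)"
  shows "(LBINT s:{0<..<t}. deriv u s) = u t - u 0"
proof -
  have "(deriv u has_integral (u t - u 0)) {0..t}"
    using assms
    by (intro fundamental_theorem_of_calculus_interior continuous_on_subset[OF cont])
      (auto simp: DERIV_deriv_iff_real_differentiable simp flip: has_real_derivative_iff_has_vector_derivative)
  then show ?thesis
    using set_borel_integral_eq_integral(2)[OF int]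
    by (simp add: has_integral_Icc_iff_Ioo integral_unique)
qed

subsection \<open>Uniqueness\<close>

text \<open>The integrands agree pointwise, so the identity also covers the default value of a
  divergent integral.\<close>

lemma caputo_deriv_eq_rl_integral:
  assumes "\<nu> \<noteq> 1"
  shows "caputo_deriv \<nu> u t = rl_integral (1 - \<nu>) (\<lambda>s. indicator {0<..} s * deriv u s) t"
proof -
  have "indicator {0<..<t} s *\<^sub>R (1 / (t - s) powr \<nu> * deriv u s) / Gamma (1 - \<nu>) =
      rl_kernel (1 - \<nu>) (t - s) * (indicator {0<..} s * deriv u s)" for s
    by (auto simp: rl_kernel_def powr_minus_divide indicator_def)
  then show ?thesis
    using assms by (simp add: caputo_deriv_def rl_integral_def set_lebesgue_integral_def
        flip: integral_divide_zero)
qed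

lemma caputo_differentiable_iff:
  assumes "\<nu> < 1"
  shows "caputo_differentiable \<nu> u t \<longleftrightarrow> (\<forall>s\<in>{0<..<t}. u differentiable (at s)) \<and>
     integrable lborel (\<lambda>s. rl_kernel (1 - \<nu>) (t - s) * (indicator {0<..} s * deriv u s))"
proof -
  have "indicator {0<..<t} s *\<^sub>R (1 / (t - s) powr \<nu> * deriv u s) =
      Gamma (1 - \<nu>) * (rl_kernel (1 - \<nu>) (t - s) * (indicator {0<..} s * deriv u s))" for s
    using Gamma_real_nonzero[of "1 - \<nu>"] assms
    by (auto simp: rl_kernel_def powr_minus_divide indicator_def)
  then show ?thesis
    using assms Gamma_real_nonzero[of "1 - \<nu>"]
    by (simp add: caputo_differentiable_def set_integrable_def)
qed

text \<open>Let g be the derivative cut off to s > 0, so that I^1 g is the cut-off of \<psi> - 1. By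
  the semigroup law, \<open>rl_integral \<nu>\<^sub>2\<close> turns both Caputo terms into integrals
  of \<psi> - 1. The integrability claims permit subtracting the equations of two solutions.\<close>

lemma relaxation_solution_volterra:
  assumes "lam > 0" "0 < \<nu>\<^sub>1" "\<nu>\<^sub>1 < \<nu>\<^sub>2" "\<nu>\<^sub>2 \<le> 1"
    and sol: "relaxation_solution lam \<nu>\<^sub>1 \<nu>\<^sub>2 n\<^sub>1 n\<^sub>2 \<psi>" and "t > 0"
  shows "integrable lborel (\<lambda>s. rl_kernel (\<nu>\<^sub>2 - \<nu>\<^sub>1) (t - s) * (indicator {0<..} s * (\<psi> s - 1)))"
    and "integrable lborel (\<lambda>s. rl_kernel \<nu>\<^sub>2 (t - s) * (indicator {0<..} s * \<psi> s))"
    and "n\<^sub>1 * rl_integral (\<nu>\<^sub>2 - \<nu>\<^sub>1) (\<lambda>s. indicator {0<..} s * (\<psi> s - 1)) t + n\<^sub>2 * (\<psi> t - 1) =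
         - lam * rl_integral \<nu>\<^sub>2 (\<lambda>s. indicator {0<..} s * \<psi> s) t"
proof -
  define g where "g s = indicator {0<..} s * deriv \<psi> s" for s
  have g0: "g s = 0" if "s \<le> 0" for s using that by (simp add: g_def)
  have cont: "continuous_on {0..} \<psi>" and init: "\<psi> 0 = 1"
    and diff1: "\<And>t. t > 0 \<Longrightarrow> caputo_differentiable \<nu>\<^sub>1 \<psi> t"
    and diff2: "\<And>t. t > 0 \<Longrightarrow> caputo_differentiable \<nu>\<^sub>2 \<psi> t"
    and eq: "\<And>t. t > 0 \<Longrightarrow> n\<^sub>1 * caputo_deriv \<nu>\<^sub>1 \<psi> t + n\<^sub>2 * caputo_deriv \<nu>\<^sub>2 \<psi> t = - lam * \<psi> t"
    using sol by (auto simp: relaxation_solution_def)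
  have "\<nu>\<^sub>1 < 1" using assms by simp
  have int1: "integrable lborel (\<lambda>s. rl_kernel (1 - \<nu>\<^sub>1) (t - s) * g s)" if "t > 0" for t
    using diff1[OF that] caputo_differentiable_iff[OF \<open>\<nu>\<^sub>1 < 1\<close>] by (simp add: g_def)
  have diff: "\<psi> differentiable (at s)" if "s > 0" for s
    using diff1[of "s + 1"] caputo_differentiable_iff[OF \<open>\<nu>\<^sub>1 < 1\<close>] that by simp
  have g [measurable]: "g \<in> borel_measurable borel"
    using rl_kernel_integrable_imp_measurable[OF _ int1] \<open>\<nu>\<^sub>1 < 1\<close> by simp
  \<comment> \<open>This covers the total orders 1 and
    \<open>\<nu>\<^sub>2 - \<nu>\<^sub>1 + 1\<close> that arise from the semigroup law.\<close>
  have int: "integrable lborel (\<lambda>s. rl_kernel \<mu> (t - s) * g s)" if "t > 0" "1 - \<nu>\<^sub>1 \<le> \<mu>" for t \<mu>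
    using integrable_rl_kernel_mono[OF _ that(2) g g0 int1[OF that(1)]] \<open>\<nu>\<^sub>1 < 1\<close> by simp
  have nonpos: "rl_integral \<mu> g s = 0" if "s \<le> 0" for \<mu> s
  proof -
    have "rl_kernel \<mu> (s - x) * g x = 0" for x
      using that by (cases "x > 0") (auto simp: g_def)
    then show ?thesis by (simp only: rl_integral_def integral_zero)
  qed
  have ftc: "rl_integral 1 g s = indicator {0<..} s * (\<psi> s - 1)" for s
  proof (cases "s > 0")
    case True
    have *: "rl_kernel 1 (s - x) * g x = indicator {0<..<s} x *\<^sub>R deriv \<psi> x" for x
      by (simp add: rl_kernel_one g_def indicator_def)
    have "set_integrable lborel {0<..<s} (deriv \<psi>)"
      using int[OF True, of 1] assms by (simp add: * set_integrable_def)
    from set_lebesgue_integral_deriv[OF _ cont diff this] True show ?thesis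
      by (simp add: rl_integral_def * set_lebesgue_integral_def init)
  next
    case False
    then show ?thesis by (simp add: nonpos)
  qed
  \<comment> \<open>For \<open>\<nu>\<^sub>2 = 1\<close> the order is 0, where
    \<open>rl_kernel\<close> is identically 0 because \<open>Gamma 0 = 0\<close>; I^0 g = g is
    therefore put in by hand.\<close>
  define G where "G = (if \<nu>\<^sub>2 = 1 then g else rl_integral (1 - \<nu>\<^sub>2) g)"
  have G: "integrable lborel (\<lambda>s. rl_kernel \<nu>\<^sub>2 (t - s) * G s)"
    and rl_G: "rl_integral \<nu>\<^sub>2 G t = \<psi> t - 1"
    using int[OF \<open>t > 0\<close>, of 1] assms ftc
      integrable_rl_integral[of \<nu>\<^sub>2 "1 - \<nu>\<^sub>2" g t] rl_integral_rl_integral[of \<nu>\<^sub>2 "1 - \<nu>\<^sub>2" g t]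
    by (auto simp: G_def)
  have H: "integrable lborel (\<lambda>s. rl_kernel \<nu>\<^sub>2 (t - s) * rl_integral (1 - \<nu>\<^sub>1) g s)"
    and rl_H: "rl_integral \<nu>\<^sub>2 (rl_integral (1 - \<nu>\<^sub>1) g) t = rl_integral (\<nu>\<^sub>2 - \<nu>\<^sub>1 + 1) g t"
    using int[OF \<open>t > 0\<close>, of "\<nu>\<^sub>2 - \<nu>\<^sub>1 + 1"] assms
      integrable_rl_integral[of \<nu>\<^sub>2 "1 - \<nu>\<^sub>1" g t] rl_integral_rl_integral[of \<nu>\<^sub>2 "1 - \<nu>\<^sub>1" g t]
    by (simp_all add: algebra_simps)
  have "integrable lborel (\<lambda>s. rl_kernel (\<nu>\<^sub>2 - \<nu>\<^sub>1) (t - s) * rl_integral 1 g s)"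
    and rl_f: "rl_integral (\<nu>\<^sub>2 - \<nu>\<^sub>1) (rl_integral 1 g) t = rl_integral (\<nu>\<^sub>2 - \<nu>\<^sub>1 + 1) g t"
    using int[OF \<open>t > 0\<close>, of "\<nu>\<^sub>2 - \<nu>\<^sub>1 + 1"] assms
      integrable_rl_integral[of "\<nu>\<^sub>2 - \<nu>\<^sub>1" 1 g t] rl_integral_rl_integral[of "\<nu>\<^sub>2 - \<nu>\<^sub>1" 1 g t]
    by simp_all
  then show "integrable lborel (\<lambda>s. rl_kernel (\<nu>\<^sub>2 - \<nu>\<^sub>1) (t - s) * (indicator {0<..} s * (\<psi> s - 1)))"
    by (simp add: ftc)
  have eq': "n\<^sub>1 * rl_integral (1 - \<nu>\<^sub>1) g s + n\<^sub>2 * G s = - lam * (indicator {0<..} s * \<psi> s)" for s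
  proof (cases "s > 0")
    case True
    then have "caputo_deriv \<nu>\<^sub>2 \<psi> s = G s"
      using caputo_deriv_eq_rl_integral[of \<nu>\<^sub>2 \<psi> s]
      by (auto simp: G_def g_def [abs_def] caputo_deriv_def)
    moreover have "caputo_deriv \<nu>\<^sub>1 \<psi> s = rl_integral (1 - \<nu>\<^sub>1) g s"
      using caputo_deriv_eq_rl_integral[of \<nu>\<^sub>1 \<psi> s] \<open>\<nu>\<^sub>1 < 1\<close> by (auto simp: g_def [abs_def])
    ultimately show ?thesis using eq[OF True] True by simp
  next
    case False
    then show ?thesis by (simp add: G_def nonpos g0)
  qed
  \<comment> \<open>As \<open>lam\<close> is nonzero, the equation expresses \<psi> by its two
    fractional terms and so passes their integrability on to \<psi>.\<close>
  have kernel_eq: "rl_kernel \<nu>\<^sub>2 (t - s) * (indicator {0<..} s * \<psi> s) =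
      - (1 / lam) * (n\<^sub>1 * (rl_kernel \<nu>\<^sub>2 (t - s) * rl_integral (1 - \<nu>\<^sub>1) g s)
                     + n\<^sub>2 * (rl_kernel \<nu>\<^sub>2 (t - s) * G s))" for s
  proof -
    have "n\<^sub>1 * (rl_kernel \<nu>\<^sub>2 (t - s) * rl_integral (1 - \<nu>\<^sub>1) g s) + n\<^sub>2 * (rl_kernel \<nu>\<^sub>2 (t - s) * G s) =
        rl_kernel \<nu>\<^sub>2 (t - s) * (n\<^sub>1 * rl_integral (1 - \<nu>\<^sub>1) g s + n\<^sub>2 * G s)"
      by (simp add: algebra_simps)
    then show ?thesis using \<open>lam > 0\<close> by (simp only: eq') simp
  qed
  show "integrable lborel (\<lambda>s. rl_kernel \<nu>\<^sub>2 (t - s) * (indicator {0<..} s * \<psi> s))"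
    unfolding kernel_eq using G H by (intro integrable_mult_right Bochner_Integration.integrable_add)
  have "rl_integral \<nu>\<^sub>2 (\<lambda>s. indicator {0<..} s * \<psi> s) t =
      - (1 / lam) * (n\<^sub>1 * rl_integral \<nu>\<^sub>2 (rl_integral (1 - \<nu>\<^sub>1) g) t + n\<^sub>2 * rl_integral \<nu>\<^sub>2 G t)"
    unfolding rl_integral_def[of \<nu>\<^sub>2] kernel_eq integral_mult_right_zero
    using G H by (subst Bochner_Integration.integral_add) simp_all
  then show "n\<^sub>1 * rl_integral (\<nu>\<^sub>2 - \<nu>\<^sub>1) (\<lambda>s. indicator {0<..} s * (\<psi> s - 1)) t + n\<^sub>2 * (\<psi> t - 1) =
         - lam * rl_integral \<nu>\<^sub>2 (\<lambda>s. indicator {0<..} s * \<psi> s) t"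
    using \<open>lam > 0\<close> by (simp add: rl_G rl_H rl_f flip: ftc)
qed

text \<open>In the difference of two solutions the constants cancel, leaving a homogeneous Volterra
  equation with initial value 0.\<close>

lemma relaxation_solution_unique:
  assumes "lam > 0" "0 < \<nu>\<^sub>1" "\<nu>\<^sub>1 < \<nu>\<^sub>2" "\<nu>\<^sub>2 \<le> 1" "n\<^sub>2 > 0"
    and "relaxation_solution lam \<nu>\<^sub>1 \<nu>\<^sub>2 n\<^sub>1 n\<^sub>2 \<phi>" "relaxation_solution lam \<nu>\<^sub>1 \<nu>\<^sub>2 n\<^sub>1 n\<^sub>2 \<psi>"
    and "T \<ge> 0"
  shows "\<phi> T = \<psi> T"
proof -
  let ?i = "indicator {0<..} :: real \<Rightarrow> real"
  have "\<phi> T - \<psi> T = 0"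
  proof (rule volterra_unique[where a = \<nu>\<^sub>2 and b = "\<nu>\<^sub>2 - \<nu>\<^sub>1" and A = "- lam / n\<^sub>2" and B = "- n\<^sub>1 / n\<^sub>2"
        and w = "\<lambda>t. \<phi> t - \<psi> t"])
    fix t :: real assume "t > 0"
    note \<phi> = relaxation_solution_volterra[OF assms(1-4) assms(6) \<open>t > 0\<close>]
    note \<psi> = relaxation_solution_volterra[OF assms(1-4) assms(7) \<open>t > 0\<close>]
    have d1: "rl_integral (\<nu>\<^sub>2 - \<nu>\<^sub>1) (\<lambda>s. ?i s * (\<phi> s - \<psi> s)) t =
        rl_integral (\<nu>\<^sub>2 - \<nu>\<^sub>1) (\<lambda>s. ?i s * (\<phi> s - 1)) t - rl_integral (\<nu>\<^sub>2 - \<nu>\<^sub>1) (\<lambda>s. ?i s * (\<psi> s - 1)) t"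
      unfolding rl_integral_def using \<phi>(1) \<psi>(1)
      by (subst Bochner_Integration.integral_diff [symmetric]) (simp_all add: algebra_simps)
    have d2: "rl_integral \<nu>\<^sub>2 (\<lambda>s. ?i s * (\<phi> s - \<psi> s)) t =
        rl_integral \<nu>\<^sub>2 (\<lambda>s. ?i s * \<phi> s) t - rl_integral \<nu>\<^sub>2 (\<lambda>s. ?i s * \<psi> s) t"
      unfolding rl_integral_def using \<phi>(2) \<psi>(2)
      by (subst Bochner_Integration.integral_diff [symmetric]) (simp_all add: algebra_simps)
    have "n\<^sub>2 * (\<phi> t - \<psi> t) = - n\<^sub>1 * rl_integral (\<nu>\<^sub>2 - \<nu>\<^sub>1) (\<lambda>s. ?i s * (\<phi> s - \<psi> s)) t
        - lam * rl_integral \<nu>\<^sub>2 (\<lambda>s. ?i s * (\<phi> s - \<psi> s)) t"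
      unfolding d1 d2 using \<phi>(3) \<psi>(3) by algebra
    then show "\<phi> t - \<psi> t = - n\<^sub>1 / n\<^sub>2 * rl_integral (\<nu>\<^sub>2 - \<nu>\<^sub>1) (\<lambda>s. ?i s * (\<phi> s - \<psi> s)) t
        + - lam / n\<^sub>2 * rl_integral \<nu>\<^sub>2 (\<lambda>s. ?i s * (\<phi> s - \<psi> s)) t"
      using \<open>n\<^sub>2 > 0\<close> by (simp add: field_simps)
  qed (use assms in \<open>auto simp: relaxation_solution_def intro!: continuous_intros\<close>)
  then show ?thesis by simp
qed

subsection \<open>The double series of kernels\<close>

text \<open>\<open>A\<close> and \<open>B\<close> may have any sign, and \<open>B = 0\<close> is
  included for the sake of \<open>n\<^sub>1 = 0\<close>.\<close>

locale double_kernel_series =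
  fixes a b A B :: real
  assumes a_pos: "a > 0" and b_pos: "b > 0"
begin

definition coef :: "nat \<times> nat \<Rightarrow> real" where
  "coef = (\<lambda>(r, j). real ((r + j) choose j) * A ^ j * B ^ r)"

definition expo :: "nat \<times> nat \<Rightarrow> real" where
  "expo = (\<lambda>(r, j). a * real j + b * real r)"

text \<open>An unordered sum over pairs can be read both as an ordinary series via
  \<open>prod_decode\<close> and row by row in \<open>r\<close>.\<close>

definition kernel_series :: "real \<Rightarrow> real \<Rightarrow> real" where
  "kernel_series e t = (\<Sum>\<^sub>\<infinity>p. coef p * rl_kernel (expo p + e) t)"

lemma expo_nonneg: "expo p \<ge> 0"
  using a_pos b_pos by (cases p) (simp add: expo_def)

lemma kernel_series_nonpos [simp]: "t \<le> 0 \<Longrightarrow> kernel_series e t = 0"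
  by (simp add: kernel_series_def)

section \<open>Convergence of the double series\<close>

lemma geometric_summable: "(\<lambda>p. (1 / 2 :: real) ^ fst p * (1 / 2) ^ snd p) summable_on (UNIV :: (nat \<times> nat) set)"
proof -
  have half: "(\<lambda>n. (1 / 2 :: real) ^ n) summable_on UNIV"
    by (subst summable_on_UNIV_nonneg_real_iff) (auto intro: summable_geometric)
  have "(\<lambda>p. norm ((1 / 2 :: real) ^ fst p * (1 / 2) ^ snd p)) summable_on (UNIV \<times> UNIV)"
    unfolding Infinite_Sum.abs_summable_on_Sigma_iff
    using summable_on_cmult_right[OF half] summable_on_cmult_left[OF half]
    by (simp add: infsum_cmult_right' abs_mult)
  then show ?thesis unfolding UNIV_Times_UNIV by (rule Infinite_Sum.abs_summable_summable)
qed

text \<open>The binomial coefficient is at most 2 ^ (r + j), and the decay parameter of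
  \<open>rl_kernel_bound\<close> is chosen to beat this and the powers of \<open>A\<close> and
  \<open>B\<close>. The bound is uniform on [d, T] with d > 0, since kernels of order below 1 blow
  up at 0.\<close>

lemma majorant:
  assumes "e > 0" "d > 0"
  obtains M where "M summable_on UNIV"
    and "\<And>p t. d \<le> t \<Longrightarrow> t \<le> T \<Longrightarrow> \<bar>coef p\<bar> * rl_kernel (expo p + e) t \<le> M p"
proof -
  \<comment> \<open>The summand 1 keeps \<sigma> positive; the others give \<sigma> powr a >= 4 *
    \<bar>A\<bar> and \<sigma> powr b >= 4 * \<bar>B\<bar>.\<close>
  define \<sigma> where "\<sigma> = 1 + (4 * \<bar>A\<bar>) powr (1 / a) + (4 * \<bar>B\<bar>) powr (1 / b)"
  have \<sigma>: "\<sigma> > 0" by (simp add: \<sigma>_def add_pos_nonneg)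
  have "((4 * \<bar>A\<bar>) powr (1 / a)) powr a \<le> \<sigma> powr a"
    using a_pos by (intro powr_mono2) (auto simp: \<sigma>_def)
  then have "4 * \<bar>A\<bar> \<le> \<sigma> powr a" using a_pos by (simp add: powr_powr)
  then have A: "2 * \<bar>A\<bar> * \<sigma> powr (- a) \<le> 1 / 2"
    using \<sigma> by (simp add: powr_minus field_simps)
  have "((4 * \<bar>B\<bar>) powr (1 / b)) powr b \<le> \<sigma> powr b"
    using b_pos by (intro powr_mono2) (auto simp: \<sigma>_def)
  then have "4 * \<bar>B\<bar> \<le> \<sigma> powr b" using b_pos by (simp add: powr_powr)
  then have B: "2 * \<bar>B\<bar> * \<sigma> powr (- b) \<le> 1 / 2"
    using \<sigma> by (simp add: powr_minus field_simps)
  define C where "C = exp (exp 1 * \<sigma> * T) / d * \<sigma> powr (- e)"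
  define M where "M = (\<lambda>(r, j). C * ((1 / 2) ^ r * (1 / 2) ^ j) :: real)"
  have "M summable_on UNIV"
    using summable_on_cmult_right[OF geometric_summable, of C] by (simp add: M_def case_prod_unfold)
  moreover have "\<bar>coef p\<bar> * rl_kernel (expo p + e) t \<le> M p" if t: "d \<le> t" "t \<le> T" for p t
  proof -
    obtain r j where p: "p = (r, j)" by fastforce
    have "rl_kernel (expo p + e) t \<le> exp (exp 1 * \<sigma> * t) / t * \<sigma> powr - (expo p + e)"
      using t assms \<sigma> expo_nonneg[of p] by (intro rl_kernel_bound) auto
    also have "\<dots> \<le> exp (exp 1 * \<sigma> * T) / d * \<sigma> powr - (expo p + e)"
      using t assms \<sigma> by (intro mult_right_mono frac_le) auto
    also have "\<sigma> powr - (expo p + e) = \<sigma> powr (- e) * ((\<sigma> powr (- a)) ^ j * (\<sigma> powr (- b)) ^ r)"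
      using \<sigma> by (simp add: p expo_def powr_power algebra_simps flip: powr_add)
    finally have 1: "rl_kernel (expo p + e) t \<le> C * ((\<sigma> powr (- a)) ^ j * (\<sigma> powr (- b)) ^ r)"
      by (simp add: C_def mult.assoc)
    have "real ((r + j) choose j) \<le> 2 ^ (r + j)"
      by (metis binomial_le_pow2 of_nat_le_iff of_nat_numeral of_nat_power)
    then have 2: "\<bar>coef p\<bar> \<le> 2 ^ (r + j) * \<bar>A\<bar> ^ j * \<bar>B\<bar> ^ r"
      by (simp add: p coef_def abs_mult power_abs mult_right_mono)
    have "\<bar>coef p\<bar> * rl_kernel (expo p + e) t \<le>
        (2 ^ (r + j) * \<bar>A\<bar> ^ j * \<bar>B\<bar> ^ r) * (C * ((\<sigma> powr (- a)) ^ j * (\<sigma> powr (- b)) ^ r))"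
      using 1 2 assms expo_nonneg[of p] by (intro mult_mono) (auto simp: rl_kernel_nonneg)
    also have "\<dots> = C * ((2 * \<bar>B\<bar> * \<sigma> powr (- b)) ^ r * (2 * \<bar>A\<bar> * \<sigma> powr (- a)) ^ j)"
      by (simp add: power_mult_distrib power_add)
    also have "\<dots> \<le> C * ((1 / 2) ^ r * (1 / 2) ^ j)"
      using assms A B by (intro mult_left_mono mult_mono power_mono) (auto simp: C_def)
    finally show ?thesis by (simp add: M_def p)
  qed
  ultimately show ?thesis by (rule that)
qed

lemma kernel_series_abs_summable:
  assumes "e > 0"
  shows "(\<lambda>p. \<bar>coef p\<bar> * rl_kernel (expo p + e) t) summable_on UNIV"
proof (cases "t > 0")
  case True
  obtain M where M: "M summable_on UNIV"
    "\<And>p s. t \<le> s \<Longrightarrow> s \<le> t \<Longrightarrow> \<bar>coef p\<bar> * rl_kernel (expo p + e) s \<le> M p"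
    using majorant[OF assms True, of t] by blast
  show ?thesis
    by (rule summable_on_comparison_test[OF M(1)])
      (use assms M(2)[of t] expo_nonneg in \<open>auto simp: add_nonneg_pos rl_kernel_nonneg\<close>)
qed simp

lemma kernel_series_has_sum:
  assumes "e > 0"
  shows "((\<lambda>p. coef p * rl_kernel (expo p + e) t) has_sum kernel_series e t) UNIV"
proof -
  have "(\<lambda>p. norm (coef p * rl_kernel (expo p + e) t)) summable_on UNIV"
    using kernel_series_abs_summable[OF assms] assms expo_nonneg
    by (simp add: abs_mult add_nonneg_pos rl_kernel_nonneg)
  then show ?thesis unfolding kernel_series_def by (intro has_sum_infsum) (rule Infinite_Sum.abs_summable_summable)
qed

lemma kernel_series_sums:
  assumes "e > 0"
  shows "(\<lambda>k. coef (prod_decode k) * rl_kernel (expo (prod_decode k) + e) t) sums kernel_series e t"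
  using kernel_series_has_sum[OF assms]
  by (intro has_sum_imp_sums) (subst has_sum_reindex_bij_betw[OF bij_prod_decode])

lemma kernel_series_eq_suminf:
  "e > 0 \<Longrightarrow> kernel_series e t =
     (\<Sum>k. coef (prod_decode k) * rl_kernel (expo (prod_decode k) + e) t)"
  using kernel_series_sums by (simp add: sums_iff)

lemma kernel_series_abs_summable_nat:
  assumes "e > 0"
  shows "summable (\<lambda>k. \<bar>coef (prod_decode k)\<bar> * rl_kernel (expo (prod_decode k) + e) t)"
  using kernel_series_abs_summable[OF assms]
  by (intro summable_on_imp_summable) (subst summable_on_reindex_bij_betw[OF bij_prod_decode])

section \<open>Termwise integration and differentiation; Pascal's rule\<close>

lemma
  assumes "e > 0" "\<delta> > 0"
  shows integrable_kernel_series: "integrable lborel (\<lambda>s. rl_kernel \<delta> (t - s) * kernel_series e s)"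
    and rl_integral_kernel_series: "rl_integral \<delta> (kernel_series e) t = kernel_series (e + \<delta>) t"
proof -
  let ?c = "\<lambda>k. coef (prod_decode k)" and ?x = "\<lambda>k. expo (prod_decode k) + e"
  have x: "?x k > 0" for k using expo_nonneg[of "prod_decode k"] assms by simp
  have tot: "summable (\<lambda>k. \<bar>?c k\<bar> * rl_kernel (?x k + \<delta>) t)"
    using kernel_series_abs_summable_nat[of "e + \<delta>" t] assms by (simp add: add.assoc)
  note termwise = integrable_rl_kernel_suminf[OF \<open>\<delta> > 0\<close> x kernel_series_abs_summable_nat[OF \<open>e > 0\<close>] tot]
    rl_integral_suminf[OF \<open>\<delta> > 0\<close> x kernel_series_abs_summable_nat[OF \<open>e > 0\<close>] tot]
  have eq: "kernel_series e = (\<lambda>s. \<Sum>k. ?c k * rl_kernel (?x k) s)"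
    using assms by (simp add: kernel_series_eq_suminf fun_eq_iff)
  show "integrable lborel (\<lambda>s. rl_kernel \<delta> (t - s) * kernel_series e s)"
    unfolding eq by (rule termwise)
  show "rl_integral \<delta> (kernel_series e) t = kernel_series (e + \<delta>) t"
    unfolding eq termwise(2) using assms by (simp add: kernel_series_eq_suminf add.assoc)
qed

lemma DERIV_kernel_series:
  assumes "e > 0" "t > 0"
  shows "(kernel_series (e + 1) has_real_derivative kernel_series e t) (at t)"
proof -
  let ?c = "\<lambda>k. coef (prod_decode k)" and ?x = "\<lambda>k. expo (prod_decode k) + e"
  have x: "?x k > 0" for k using expo_nonneg[of "prod_decode k"] assms by simp
  \<comment> \<open>The interval has \<open>t\<close> in its interior and stays away from 0, so the
    differentiated series converges uniformly on it.\<close>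
  obtain M where M: "M summable_on UNIV"
    "\<And>p s. t / 2 \<le> s \<Longrightarrow> s \<le> 2 * t \<Longrightarrow> \<bar>coef p\<bar> * rl_kernel (expo p + e) s \<le> M p"
    using majorant[of e "t / 2" "2 * t"] assms by auto
  have "summable (\<lambda>k. M (prod_decode k))"
    using M(1) by (intro summable_on_imp_summable) (subst summable_on_reindex_bij_betw[OF bij_prod_decode])
  then have unif: "uniformly_convergent_on {t / 2..2 * t} (\<lambda>n s. \<Sum>i<n. ?c i * rl_kernel (?x i) s)"
    by (rule Weierstrass_m_test'[rotated])
      (use M(2) x in \<open>auto simp: abs_mult rl_kernel_nonneg less_imp_le\<close>)
  have "((\<lambda>s. \<Sum>k. ?c k * rl_kernel (?x k + 1) s) has_real_derivative (\<Sum>k. ?c k * rl_kernel (?x k) t)) (at t)"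
  proof (rule has_field_derivative_series'(2)[OF _ _ unif])
    show "((\<lambda>s. ?c k * rl_kernel (?x k + 1) s) has_real_derivative ?c k * rl_kernel (?x k) s)
            (at s within {t / 2..2 * t})" if "s \<in> {t / 2..2 * t}" for k s
      using that assms x by (intro DERIV_cmult has_field_derivative_at_within[OF DERIV_rl_kernel]) auto
    show "summable (\<lambda>k. ?c k * rl_kernel (?x k + 1) t)"
      using kernel_series_sums[of "e + 1" t] assms by (simp add: sums_iff add.assoc)
  qed (use assms in auto)
  moreover have "kernel_series (e + 1) = (\<lambda>s. \<Sum>k. ?c k * rl_kernel (?x k + 1) s)"
    using assms by (simp add: kernel_series_eq_suminf fun_eq_iff add.assoc)
  ultimately show ?thesis using assms by (simp add: kernel_series_eq_suminf)
qed

text \<open>Pascal's rule splits every coefficient except the one at (0, 0). Raising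
  \<open>j\<close> by one costs a factor \<open>A\<close> and adds \<open>a\<close> to the order;
  raising \<open>r\<close> does the same with \<open>B\<close> and \<open>b\<close>.\<close>

lemma kernel_series_pascal:
  assumes "e > 0"
  shows "kernel_series e t = rl_kernel e t + A * kernel_series (e + a) t + B * kernel_series (e + b) t"
proof -
  let ?H = "\<lambda>(r, j). rl_kernel (expo (r, j) + e) t"
  \<comment> \<open>These are the corner and the two Pascal parts, extended by zero to all pairs;
    the tests for 0 guard the truncated subtractions.\<close>
  define f0 where "f0 p = (if p = (0, 0) then rl_kernel e t else 0)" for p :: "nat \<times> nat"
  define fj where "fj = (\<lambda>(r, j). if j = 0 then 0 else
    real ((r + (j - 1)) choose (j - 1)) * A ^ j * B ^ r * ?H (r, j))"
  define fr where "fr = (\<lambda>(r, j). if r = 0 then 0 else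
    real ((r - 1 + j) choose j) * A ^ j * B ^ r * ?H (r, j))"
  have "(f0 has_sum rl_kernel e t) {(0, 0)}"
    by (rule has_sum_finiteI) (auto simp: f0_def)
  also have "?this \<longleftrightarrow> (f0 has_sum rl_kernel e t) UNIV"
    by (rule has_sum_cong_neutral) (auto simp: f0_def)
  finally have f0: "(f0 has_sum rl_kernel e t) UNIV" .
  have "((\<lambda>p. A * (coef p * rl_kernel (expo p + (e + a)) t)) has_sum A * kernel_series (e + a) t) UNIV"
    using assms a_pos by (intro has_sum_cmult_right kernel_series_has_sum) auto
  also have "(\<lambda>p. A * (coef p * rl_kernel (expo p + (e + a)) t)) = fj \<circ> (\<lambda>(r, j). (r, Suc j))"
    by (auto simp: fun_eq_iff coef_def expo_def fj_def algebra_simps)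
  also have "(\<dots> has_sum A * kernel_series (e + a) t) UNIV \<longleftrightarrow>
      (fj has_sum A * kernel_series (e + a) t) (range (\<lambda>(r, j). (r, Suc j)))"
    by (rule has_sum_reindex [symmetric]) (auto simp: inj_on_def)
  also have "\<dots> \<longleftrightarrow> (fj has_sum A * kernel_series (e + a) t) UNIV"
    by (rule has_sum_cong_neutral) (auto simp: fj_def image_iff gr0_conv_Suc)
  finally have fj: "(fj has_sum A * kernel_series (e + a) t) UNIV" .
  have "((\<lambda>p. B * (coef p * rl_kernel (expo p + (e + b)) t)) has_sum B * kernel_series (e + b) t) UNIV"
    using assms b_pos by (intro has_sum_cmult_right kernel_series_has_sum) auto
  also have "(\<lambda>p. B * (coef p * rl_kernel (expo p + (e + b)) t)) = fr \<circ> (\<lambda>(r, j). (Suc r, j))"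
    by (auto simp: fun_eq_iff coef_def expo_def fr_def algebra_simps)
  also have "(\<dots> has_sum B * kernel_series (e + b) t) UNIV \<longleftrightarrow>
      (fr has_sum B * kernel_series (e + b) t) (range (\<lambda>(r, j). (Suc r, j)))"
    by (rule has_sum_reindex [symmetric]) (auto simp: inj_on_def)
  also have "\<dots> \<longleftrightarrow> (fr has_sum B * kernel_series (e + b) t) UNIV"
    by (rule has_sum_cong_neutral) (auto simp: fr_def image_iff gr0_conv_Suc)
  finally have fr: "(fr has_sum B * kernel_series (e + b) t) UNIV" .
  have "coef p * rl_kernel (expo p + e) t = f0 p + fj p + fr p" for p
  proof -
    obtain r j where p: "p = (r, j)" by fastforce
    show ?thesis
      by (cases r; cases j) (auto simp: p coef_def f0_def fj_def fr_def expo_def algebra_simps)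
  qed
  then have "((\<lambda>p. coef p * rl_kernel (expo p + e) t) has_sum
      (rl_kernel e t + A * kernel_series (e + a) t + B * kernel_series (e + b) t)) UNIV"
    using has_sum_add[OF has_sum_add[OF f0 fj] fr] by simp
  then show ?thesis
    using kernel_series_has_sum[OF assms] by (rule has_sum_unique[symmetric])
qed

section \<open>Continuity up to the origin\<close>

text \<open>The bound of \<open>majorant\<close> degenerates at 0. For 0 < t < 1 every order is at
  least a + 1, so each term is at most t powr a times its value at 1.\<close>

lemma kernel_series_tendsto_0: "(kernel_series (a + 1) \<longlongrightarrow> 0) (at_right 0)"
proof -
  define N where "N = (\<Sum>\<^sub>\<infinity>p. \<bar>coef p\<bar> * rl_kernel (expo p + (a + 1)) 1)"
  have bound: "norm (kernel_series (a + 1) t) \<le> t powr a * N" if t: "0 < t" "t < 1" for t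
  proof -
    have s: "(\<lambda>p. \<bar>coef p\<bar> * rl_kernel (expo p + (a + 1)) t) summable_on UNIV" for t
      using a_pos by (intro kernel_series_abs_summable) simp
    have pos: "expo p + (a + 1) > 0" for p using expo_nonneg[of p] a_pos by simp
    have abs_eq: "norm (coef p * rl_kernel (expo p + (a + 1)) t) = \<bar>coef p\<bar> * rl_kernel (expo p + (a + 1)) t" for p t
      using pos[of p] by (simp add: abs_mult rl_kernel_nonneg)
    have "norm (kernel_series (a + 1) t) \<le> (\<Sum>\<^sub>\<infinity>p. \<bar>coef p\<bar> * rl_kernel (expo p + (a + 1)) t)"
      unfolding kernel_series_def using norm_infsum_bound[of "\<lambda>p. coef p * rl_kernel (expo p + (a + 1)) t" UNIV] s[of t]
      by (simp only: abs_eq)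
    also have "\<dots> \<le> (\<Sum>\<^sub>\<infinity>p. t powr a * (\<bar>coef p\<bar> * rl_kernel (expo p + (a + 1)) 1))"
    proof (rule infsum_mono)
      show "\<bar>coef p\<bar> * rl_kernel (expo p + (a + 1)) t \<le> t powr a * (\<bar>coef p\<bar> * rl_kernel (expo p + (a + 1)) 1)" for p
      proof -
        have "t powr (expo p + a) \<le> t powr a"
          using t expo_nonneg[of p] by (intro powr_mono') auto
        then have "rl_kernel (expo p + (a + 1)) t \<le> t powr a * rl_kernel (expo p + (a + 1)) 1"
          using t Gamma_real_pos[OF pos[of p]] by (simp add: rl_kernel_def divide_right_mono)
        then show ?thesis
          by (metis abs_ge_zero mult.left_commute mult_left_mono)
      qed
    qed (use s in \<open>auto intro: summable_on_cmult_right\<close>)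
    also have "\<dots> = t powr a * N"
      by (simp add: N_def infsum_cmult_right')
    finally show ?thesis .
  qed
  have "((\<lambda>t. t powr a * N) \<longlongrightarrow> 0 powr a * N) (at_right 0)"
    using a_pos by (intro tendsto_intros tendsto_powr' tendsto_ident_at)
      (auto simp: eventually_at_right_less less_imp_le intro: eventually_mono[OF eventually_at_right_less])
  then have "((\<lambda>t. t powr a * N) \<longlongrightarrow> 0) (at_right 0)" using a_pos by simp
  moreover have "\<forall>\<^sub>F t in at_right 0. norm (kernel_series (a + 1) t) \<le> t powr a * N"
    by (rule eventually_at_rightI[of 0 1]) (use bound in auto)
  ultimately show ?thesis by (rule Lim_null_comparison[rotated])
qed

lemma continuous_on_kernel_series: "continuous_on {0..} (kernel_series (a + 1))"
  unfolding continuous_on_def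
proof
  fix t :: real assume t: "t \<in> {0..}"
  show "(kernel_series (a + 1) \<longlongrightarrow> kernel_series (a + 1) t) (at t within {0..})"
  proof (cases "t = 0")
    case True
    then show ?thesis using kernel_series_tendsto_0 by (simp add: at_within_Ici_at_right)
  next
    case False
    then have "isCont (kernel_series (a + 1)) t"
      using DERIV_isCont[OF DERIV_kernel_series[OF a_pos, of t]] t by simp
    then show ?thesis
      unfolding isCont_def by (rule tendsto_within_subset) simp
  qed
qed

section \<open>Rows of the double series as Mittag-Leffler functions\<close>

text \<open>Since \<open>pochhammer (real r + 1) j / fact j\<close> is a binomial coefficient, row
  \<open>r\<close> is a Mittag-Leffler series times t powr a * (B * t powr b) ^ r. Absolute
  summability permits summing by rows; cancelling the factor for every row takes
  \<open>B \<noteq> 0\<close>.\<close>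

lemma kernel_series_eq_mittag_leffler:
  assumes "t > 0"
  shows "B \<noteq> 0 \<Longrightarrow> summable (gen_mittag_leffler_term (real r + 1) a (a + b * real r + 1) (A * t powr a))"
    and "(\<lambda>r. t powr a * ((B * t powr b) ^ r *
            gen_mittag_leffler (real r + 1) a (a + b * real r + 1) (A * t powr a)))
         sums kernel_series (a + 1) t"
proof -
  let ?T = "\<lambda>r. gen_mittag_leffler_term (real r + 1) a (a + b * real r + 1) (A * t powr a)"
  define F where "F p = coef p * rl_kernel (expo p + (a + 1)) t" for p
  have F: "F (r, j) = t powr a * (B * t powr b) ^ r * ?T r j" for r j
  proof -
    have "real ((r + j) choose j) = pochhammer (real r + 1) j / fact j"
      by (simp add: binomial_gbinomial gbinomial_pochhammer' add.commute)
    moreover have "t powr (expo (r, j) + a) = t powr a * (t powr b) ^ r * (t powr a) ^ j"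
      using assms by (simp add: expo_def powr_power algebra_simps flip: powr_add)
    ultimately show ?thesis
      using assms by (simp add: F_def coef_def rl_kernel_def gen_mittag_leffler_term_def expo_def
          power_mult_distrib add_ac)
  qed
  have "(\<lambda>p. norm (F p)) summable_on (UNIV \<times> UNIV)"
    using kernel_series_abs_summable[of "a + 1" t] a_pos expo_nonneg
    by (simp add: F_def abs_mult add_nonneg_pos rl_kernel_nonneg)
  then have inner: "(\<lambda>j. norm (F (r, j))) summable_on UNIV" for r
    unfolding Infinite_Sum.abs_summable_on_Sigma_iff by blast
  then have inner_has_sum: "((\<lambda>j. F (r, j)) has_sum (\<Sum>\<^sub>\<infinity>j. F (r, j))) UNIV" for r
    by (intro has_sum_infsum) (rule Infinite_Sum.abs_summable_summable)
  then have inner_sums: "(\<lambda>j. F (r, j)) sums (\<Sum>\<^sub>\<infinity>j. F (r, j))" for r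
    by (rule has_sum_imp_sums)
  show "summable (?T r)" if "B \<noteq> 0"
    using inner_sums[of r] assms that by (simp add: F sums_iff summable_cmult_iff)
  \<comment> \<open>If the power of B * t powr b vanishes, both sides are 0; otherwise the factor
    cancels.\<close>
  have row: "(\<Sum>\<^sub>\<infinity>j. F (r, j)) = t powr a * ((B * t powr b) ^ r *
      gen_mittag_leffler (real r + 1) a (a + b * real r + 1) (A * t powr a))" for r
  proof (cases "(B * t powr b) ^ r = 0")
    case True
    then show ?thesis by (simp only: F mult_zero_left mult_zero_right infsum_0)
  next
    case False
    then have "t powr a * (B * t powr b) ^ r \<noteq> 0" using assms by simp
    moreover have "summable (\<lambda>j. t powr a * (B * t powr b) ^ r * ?T r j)"
      using inner_sums[of r] by (simp only: F sums_iff)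
    ultimately have "summable (?T r)" by (simp only: summable_cmult_iff) simp
    from suminf_mult[OF this, of "t powr a * (B * t powr b) ^ r"] show ?thesis
      using inner_sums[of r] by (simp only: F sums_iff gen_mittag_leffler_def mult.assoc)
  qed
  have "(F has_sum kernel_series (a + 1) t) (UNIV \<times> UNIV)"
    using kernel_series_has_sum[of "a + 1" t] a_pos by (simp add: F_def [abs_def])
  then have "((\<lambda>r. \<Sum>\<^sub>\<infinity>j. F (r, j)) has_sum kernel_series (a + 1) t) UNIV"
    using inner_has_sum by (rule has_sum_Sigma')
  then show "(\<lambda>r. t powr a * ((B * t powr b) ^ r *
            gen_mittag_leffler (real r + 1) a (a + b * real r + 1) (A * t powr a)))
         sums kernel_series (a + 1) t"
    by (intro has_sum_imp_sums) (simp only: row)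
qed

end

subsection \<open>The relaxation equation\<close>

lemma relaxation_solution_kernel_series:
  fixes lam \<nu>\<^sub>1 \<nu>\<^sub>2 n\<^sub>1 n\<^sub>2 :: real
  defines "Ser \<equiv> double_kernel_series.kernel_series \<nu>\<^sub>2 (\<nu>\<^sub>2 - \<nu>\<^sub>1) (- (lam / n\<^sub>2)) (- (n\<^sub>1 / n\<^sub>2))"
  assumes "0 < \<nu>\<^sub>1" "\<nu>\<^sub>1 < \<nu>\<^sub>2" "\<nu>\<^sub>2 \<le> 1" "n\<^sub>2 > 0"
    and \<psi>: "\<And>t. t \<ge> 0 \<Longrightarrow> \<psi> t = 1 - lam / n\<^sub>2 * Ser (\<nu>\<^sub>2 + 1) t"
  shows "relaxation_solution lam \<nu>\<^sub>1 \<nu>\<^sub>2 n\<^sub>1 n\<^sub>2 \<psi>"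
proof -
  interpret S: double_kernel_series \<nu>\<^sub>2 "\<nu>\<^sub>2 - \<nu>\<^sub>1" "- (lam / n\<^sub>2)" "- (n\<^sub>1 / n\<^sub>2)"
    using assms by unfold_locales auto
  note Ser = Ser_def [symmetric]
  have deriv: "(\<psi> has_real_derivative - (lam / n\<^sub>2) * Ser \<nu>\<^sub>2 t) (at t)" if "t > 0" for t
  proof (rule has_field_derivative_transform_within_open)
    show "((\<lambda>t. 1 - lam / n\<^sub>2 * Ser (\<nu>\<^sub>2 + 1) t) has_real_derivative - (lam / n\<^sub>2) * Ser \<nu>\<^sub>2 t) (at t)"
      using assms that unfolding Ser_def by (auto intro!: derivative_eq_intros S.DERIV_kernel_series)
    show "open {0::real<..}" "t \<in> {0<..}" using that by auto
  qed (simp add: \<psi>)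
  have \<psi>': "indicator {0<..} s * deriv \<psi> s = - (lam / n\<^sub>2) * Ser \<nu>\<^sub>2 s" for s
    using DERIV_imp_deriv[OF deriv, of s] by (cases "s > 0") (auto simp: Ser_def)
  have diff: "\<psi> differentiable (at t)" if "t > 0" for t
    using deriv[OF that] real_differentiable_def by blast
  \<comment> \<open>One formula serves both orders, including the ordinary derivative at \<nu> =
    1.\<close>
  have caputo: "caputo_differentiable \<nu> \<psi> t" "caputo_deriv \<nu> \<psi> t = - (lam / n\<^sub>2) * Ser (\<nu>\<^sub>2 + 1 - \<nu>) t"
    if "\<nu> \<le> 1" "t > 0" for \<nu> t
  proof -
    have "caputo_differentiable \<nu> \<psi> t \<and> caputo_deriv \<nu> \<psi> t = - (lam / n\<^sub>2) * Ser (\<nu>\<^sub>2 + 1 - \<nu>) t"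
    proof (cases "\<nu> = 1")
      case True
      then show ?thesis using deriv[OF \<open>t > 0\<close>] diff[OF \<open>t > 0\<close>]
        by (simp add: caputo_differentiable_def caputo_deriv_def DERIV_imp_deriv)
    next
      case False
      then have \<nu>: "\<nu> < 1" using that by simp
      have "rl_kernel (1 - \<nu>) (t - s) * (indicator {0<..} s * deriv \<psi> s) =
          - (lam / n\<^sub>2) * (rl_kernel (1 - \<nu>) (t - s) * Ser \<nu>\<^sub>2 s)" for s
        by (simp add: \<psi>')
      moreover have "integrable lborel (\<lambda>s. rl_kernel (1 - \<nu>) (t - s) * Ser \<nu>\<^sub>2 s)"
        using \<nu> assms unfolding Ser_def by (intro S.integrable_kernel_series) auto
      moreover have "rl_integral (1 - \<nu>) (Ser \<nu>\<^sub>2) t = Ser (\<nu>\<^sub>2 + 1 - \<nu>) t"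
        using \<nu> assms unfolding Ser_def by (subst S.rl_integral_kernel_series) (auto simp: algebra_simps)
      ultimately show ?thesis
        using \<nu> diff
        by (auto simp only: caputo_differentiable_iff caputo_deriv_eq_rl_integral[OF False]
            rl_integral_def integral_mult_right_zero greaterThanLessThan_iff
            intro: integrable_mult_right)
    qed
    then show "caputo_differentiable \<nu> \<psi> t" "caputo_deriv \<nu> \<psi> t = - (lam / n\<^sub>2) * Ser (\<nu>\<^sub>2 + 1 - \<nu>) t"
      by auto
  qed
  have eq: "n\<^sub>1 * caputo_deriv \<nu>\<^sub>1 \<psi> t + n\<^sub>2 * caputo_deriv \<nu>\<^sub>2 \<psi> t = - lam * \<psi> t" if "t > 0" for t
  proof -
    \<comment> \<open>Pascal's rule is taken at e = 1, where the kernel is the constant 1 for t >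
      0.\<close>
    have "Ser 1 t = 1 - lam / n\<^sub>2 * Ser (\<nu>\<^sub>2 + 1) t - n\<^sub>1 / n\<^sub>2 * Ser (\<nu>\<^sub>2 + 1 - \<nu>\<^sub>1) t"
      using S.kernel_series_pascal[of 1 t] that by (simp add: Ser rl_kernel_one algebra_simps)
    then have "Ser 1 t = \<psi> t - n\<^sub>1 / n\<^sub>2 * Ser (\<nu>\<^sub>2 + 1 - \<nu>\<^sub>1) t"
      using \<psi>[of t] that by simp
    then have "n\<^sub>2 * Ser 1 t = n\<^sub>2 * \<psi> t - n\<^sub>1 * Ser (\<nu>\<^sub>2 + 1 - \<nu>\<^sub>1) t"
      using \<open>n\<^sub>2 > 0\<close> by (simp add: field_simps)
    moreover have "caputo_deriv \<nu>\<^sub>1 \<psi> t = - (lam / n\<^sub>2) * Ser (\<nu>\<^sub>2 + 1 - \<nu>\<^sub>1) t"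
      "caputo_deriv \<nu>\<^sub>2 \<psi> t = - (lam / n\<^sub>2) * Ser 1 t"
      using caputo(2)[of _ t] that assms(2-4) by simp_all
    ultimately have "n\<^sub>1 * caputo_deriv \<nu>\<^sub>1 \<psi> t + n\<^sub>2 * caputo_deriv \<nu>\<^sub>2 \<psi> t = - (lam / n\<^sub>2) * (n\<^sub>2 * \<psi> t)"
      by algebra
    then show ?thesis using \<open>n\<^sub>2 > 0\<close> by simp
  qed
  have "continuous_on {0..} (\<lambda>t. 1 - lam / n\<^sub>2 * Ser (\<nu>\<^sub>2 + 1) t)"
    unfolding Ser_def by (intro continuous_intros S.continuous_on_kernel_series)
  then have "continuous_on {0..} \<psi>"
    by (subst continuous_on_cong[OF refl \<psi>]) auto
  moreover have "\<psi> 0 = 1" using \<psi>[of 0] by (simp add: Ser_def)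
  ultimately show ?thesis
    unfolding relaxation_solution_def using caputo(1) eq assms(2-4) by simp
qed

text \<open>The equivalence combines existence and uniqueness; the two summability claims ensure
  that the sums are not default values.\<close>

theorem theorem3p1:
  fixes lam \<nu>\<^sub>1 \<nu>\<^sub>2 n\<^sub>1 n\<^sub>2 :: real
  assumes "lam > 0"
    and "0 < \<nu>\<^sub>1" and "\<nu>\<^sub>1 < \<nu>\<^sub>2" and "\<nu>\<^sub>2 \<le> 1"
    and "n\<^sub>1 \<ge> 0" and "n\<^sub>2 > 0" and "n\<^sub>1 + n\<^sub>2 = 1"
  shows "(\<forall>t\<ge>0. \<forall>r::nat. summable
           (gen_mittag_leffler_term (real r + 1) \<nu>\<^sub>2 (\<nu>\<^sub>2 + (\<nu>\<^sub>2 - \<nu>\<^sub>1) * real r + 1)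
              (- (lam * t powr \<nu>\<^sub>2 / n\<^sub>2)))) \<and>
         (\<forall>t\<ge>0. summable (\<lambda>r::nat. (- (n\<^sub>1 * t powr (\<nu>\<^sub>2 - \<nu>\<^sub>1) / n\<^sub>2)) ^ r *
           gen_mittag_leffler (real r + 1) \<nu>\<^sub>2 (\<nu>\<^sub>2 + (\<nu>\<^sub>2 - \<nu>\<^sub>1) * real r + 1)
             (- (lam * t powr \<nu>\<^sub>2 / n\<^sub>2)))) \<and>
         (\<forall>\<psi> :: real \<Rightarrow> real. relaxation_solution lam \<nu>\<^sub>1 \<nu>\<^sub>2 n\<^sub>1 n\<^sub>2 \<psi> \<longleftrightarrow>
           (\<forall>t\<ge>0. \<psi> t = 1 - lam * t powr \<nu>\<^sub>2 / n\<^sub>2 *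
             (\<Sum>r::nat. (- (n\<^sub>1 * t powr (\<nu>\<^sub>2 - \<nu>\<^sub>1) / n\<^sub>2)) ^ r *
               gen_mittag_leffler (real r + 1) \<nu>\<^sub>2 (\<nu>\<^sub>2 + (\<nu>\<^sub>2 - \<nu>\<^sub>1) * real r + 1)
                 (- (lam * t powr \<nu>\<^sub>2 / n\<^sub>2)))))"
    (is "?inner \<and> ?outer \<and> (\<forall>\<psi>. _ \<longleftrightarrow> (\<forall>t\<ge>0. \<psi> t = ?\<Psi> t))")
proof -
  interpret S: double_kernel_series \<nu>\<^sub>2 "\<nu>\<^sub>2 - \<nu>\<^sub>1" "- (lam / n\<^sub>2)" "- (n\<^sub>1 / n\<^sub>2)"
    using assms by unfold_locales auto
  \<comment> \<open>For \<open>n\<^sub>1 = 0\<close> the rows \<open>r > 0\<close> of the double series vanish and say nothing about the inner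
    sums; these do not depend on \<open>B\<close>, so \<open>B = 1\<close> may be used instead.\<close>
  interpret S1: double_kernel_series \<nu>\<^sub>2 "\<nu>\<^sub>2 - \<nu>\<^sub>1" "- (lam / n\<^sub>2)" 1
    using assms by unfold_locales auto
  let ?u = "\<lambda>t r. (- (n\<^sub>1 * t powr (\<nu>\<^sub>2 - \<nu>\<^sub>1) / n\<^sub>2)) ^ r *
           gen_mittag_leffler (real r + 1) \<nu>\<^sub>2 (\<nu>\<^sub>2 + (\<nu>\<^sub>2 - \<nu>\<^sub>1) * real r + 1)
             (- (lam * t powr \<nu>\<^sub>2 / n\<^sub>2))"
  have inner: ?inner
  proof (intro allI impI)
    fix t :: real and r :: nat assume "t \<ge> 0"
    show "summable (gen_mittag_leffler_term (real r + 1) \<nu>\<^sub>2 (\<nu>\<^sub>2 + (\<nu>\<^sub>2 - \<nu>\<^sub>1) * real r + 1)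
              (- (lam * t powr \<nu>\<^sub>2 / n\<^sub>2)))"
    proof (cases "t = 0")
      case True
      \<comment> \<open>At t = 0 the argument is 0, and only the term j = 0 survives.\<close>
      then show ?thesis
        by (intro summable_finite[of "{0}"]) (auto simp: gen_mittag_leffler_term_def)
    next
      case False
      then show ?thesis
        using S1.kernel_series_eq_mittag_leffler(1)[of t r] \<open>t \<ge> 0\<close> by simp
    qed
  qed
  have sums: "(\<lambda>r. t powr \<nu>\<^sub>2 * ?u t r) sums S.kernel_series (\<nu>\<^sub>2 + 1) t" if "t > 0" for t
    using S.kernel_series_eq_mittag_leffler(2)[OF that] by simp
  have summable: "summable (?u t)" if "t > 0" for t
    using sums[OF that] that by (simp add: sums_iff summable_cmult_iff)
  have outer: ?outer
  proof (intro allI impI)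
    fix t :: real assume "t \<ge> 0"
    show "summable (?u t)"
    proof (cases "t = 0")
      case True
      then show ?thesis by (intro summable_finite[of "{0}"]) auto
    next
      case False
      then show ?thesis using summable \<open>t \<ge> 0\<close> by simp
    qed
  qed
  have \<Psi>: "?\<Psi> t = 1 - lam / n\<^sub>2 * S.kernel_series (\<nu>\<^sub>2 + 1) t" if "t \<ge> 0" for t
  \<comment> \<open>At t = 0 both \<open>t powr \<nu>\<^sub>2\<close> and the kernel series are
    0.\<close>
  proof (cases "t = 0")
    case False
    with that have "t > 0" by simp
    then have "t powr \<nu>\<^sub>2 * (\<Sum>r. ?u t r) = S.kernel_series (\<nu>\<^sub>2 + 1) t"
      using sums summable by (simp only: sums_iff suminf_mult)
    from this [symmetric] show ?thesis by simp
  qed simp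
  have solution: "relaxation_solution lam \<nu>\<^sub>1 \<nu>\<^sub>2 n\<^sub>1 n\<^sub>2 \<psi>" if "\<forall>t\<ge>0. \<psi> t = ?\<Psi> t" for \<psi>
    using that \<Psi> by (intro relaxation_solution_kernel_series assms) simp
  have unique: "\<psi> t = ?\<Psi> t" if "relaxation_solution lam \<nu>\<^sub>1 \<nu>\<^sub>2 n\<^sub>1 n\<^sub>2 \<psi>" "t \<ge> 0" for \<psi> t
    \<comment> \<open>The comparison function is the asserted formula itself, a solution by
      \<open>solution\<close>.\<close>
    by (rule relaxation_solution_unique[OF assms(1-4,6) that(1) _ that(2)]) (rule solution, simp)
  show ?thesis
    by (intro conjI inner outer allI iffI impI) (erule (1) unique, erule solution)
qed

end
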